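(* Let $W=\mathcal{S}_{n+1}$ be the Weyl group of type $A_n$, and fix $i$ with $1\le i\le n-1$. Consider two left cosets $wW^{(i)}$ and $w'W^{(i+1)}$ with $w,w'\in W$, and let $J=w\cdot\{1,\dots,i\}$ and $J'=w'\cdot\{1,\dots,i+1\}$ be the corresponding multi-indices. Then $wW^{(i)}$ and $w'W^{(i+1)}$ are adjacent in $\Sigma^{op}$ if and only if $J\subset J'$.
   Context: In type $A_n$ the Weyl group is $W=\mathcal{S}_{n+1}$ with simple reflections $s_i=(i\ \,i+1)$, $1\le i\le n$. For $1\le i\le n$, $W^{(i)}$ is the subgroup generated by all $s_j$ with $j\neq i$; it is the stabilizer of the fundamental weight $\omega_i$, and also the stabilizer of the set $\{1,\dots,i\}$. Left cosets $wW^{(i)}$ (equivalently weights $w\omega_i$) are thereby identified with strictly increasing multi-indices of size $i$ with entries in $\{1,\dots,n+1\}$, i.e. $i$-element subsets, via $wW^{(i)}\leftrightarrow w\cdot\{1,\dots,i\}$. $\Sigma^{op}$ is the inversely ordered Coxeter complex: the poset of left classes of all parabolic subgroups of $W$, ordered by inclusion. Its facets are the left classes of the maximal parabolic subgroups $W^{(i)}$. Two facets $wW^{(i)}$ and $w'W^{(j)}$ are adjacent iff $wW^{(i)}\cap w'W^{(j)}\neq\emptyset$. *)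

theory Defs
  imports "HOL-Algebra.Sym_Groups"
begin

definition weyl_group :: "nat \<Rightarrow> (nat \<Rightarrow> nat) monoid"
  where "weyl_group n = sym_group (n + 1)"

definition simple_reflection :: "nat \<Rightarrow> nat \<Rightarrow> nat"
  where "simple_reflection i = Transposition.transpose i (i + 1)"

text \<open>Meant for \<^term>\<open>S \<subseteq> {1..n}\<close>; otherwise the generators may lie outside the group.\<close>
definition parabolic :: "nat \<Rightarrow> nat set \<Rightarrow> (nat \<Rightarrow> nat) set"
  where "parabolic n S = generate (weyl_group n) (simple_reflection ` S)"

definition max_parabolic :: "nat \<Rightarrow> nat \<Rightarrow> (nat \<Rightarrow> nat) set"
  where "max_parabolic n i = parabolic n ({1..n} - {i})"

text \<open>The underlying set of the inversely ordered Coxeter complex; its order is inclusion of cosets.\<close>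
definition Sigma_op :: "nat \<Rightarrow> (nat \<Rightarrow> nat) set set"
  where "Sigma_op n =
    {w <#\<^bsub>weyl_group n\<^esub> parabolic n S | w S. w \<in> carrier (weyl_group n) \<and> S \<subseteq> {1..n}}"

definition facets :: "nat \<Rightarrow> (nat \<Rightarrow> nat) set set"
  where "facets n =
    {w <#\<^bsub>weyl_group n\<^esub> max_parabolic n i | w i. w \<in> carrier (weyl_group n) \<and> i \<in> {1..n}}"

lemma facets_subset_Sigma_op: "facets n \<subseteq> Sigma_op n"
  unfolding facets_def Sigma_op_def max_parabolic_def by blast

definition adjacent :: "nat \<Rightarrow> (nat \<Rightarrow> nat) set \<Rightarrow> (nat \<Rightarrow> nat) set \<Rightarrow> bool"
  where "adjacent n F F' \<longleftrightarrow> F \<in> facets n \<and> F' \<in> facets n \<and> F \<inter> F' \<noteq> {}"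

text \<open>
  A strictly increasing multi-index is represented by its set of entries.
\<close>
definition multi_index :: "(nat \<Rightarrow> nat) \<Rightarrow> nat \<Rightarrow> nat set"
  where "multi_index w i = w ` {1..i}"

end

theory Submission
  imports Defs
begin

text \<open>
  The group \<open>W\<^sup>(\<^sup>i\<^sup>)\<close> is the full stabilizer of \<open>{1..i}\<close>, because each of the two blocks
  \<open>{1..i}\<close> and \<open>{i+1..n+1}\<close> is permuted arbitrarily by products of adjacent transpositions
  inside it. Hence the cosets meet iff some \<open>u\<close> in \<open>W\<close> satisfies \<open>u{1..i} = J\<close> and
  \<open>u{1..i+1} = J'\<close>, which forces \<open>J \<subseteq> J'\<close>. Conversely, if \<open>J \<subseteq> J'\<close>, then \<open>J' - J\<close> is a single
  point \<open>w' y\<close> with \<open>y \<le> i + 1\<close>, and \<open>u = w' \<circ> (y i+1)\<close> works.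
\<close>

lemma carrier_weyl_group: "p \<in> carrier (weyl_group n) \<longleftrightarrow> p permutes {1..n + 1}"
  by (simp add: weyl_group_def sym_group_carrier)

lemma mult_weyl_group: "mult (weyl_group n) = (\<circ>)"
  by (simp add: weyl_group_def sym_group_mult)

lemma l_coset_weyl_group: "w <#\<^bsub>weyl_group n\<^esub> H = (\<circ>) w ` H"
  by (auto simp: l_coset_def mult_weyl_group)

lemma id_in_parabolic: "id \<in> parabolic n S"
  using generate.one[of "weyl_group n"]
  by (simp add: parabolic_def weyl_group_def sym_group_one)

lemma comp_in_parabolic:
  "p \<in> parabolic n S \<Longrightarrow> q \<in> parabolic n S \<Longrightarrow> p \<circ> q \<in> parabolic n S"
  unfolding parabolic_def using generate.eng[of p "weyl_group n" _ q]
  by (simp add: mult_weyl_group)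

lemma apply_adj_transps_in_parabolic:
  "set xs \<subseteq> S \<Longrightarrow> apply_adj_transps xs \<in> parabolic n S"
proof (induction xs)
  case (Cons x xs)
  have "simple_reflection x \<in> parabolic n S"
    using Cons.prems by (auto simp: parabolic_def intro: generate.incl)
  then have "simple_reflection x \<circ> apply_adj_transps xs \<in> parabolic n S"
    using Cons by (intro comp_in_parabolic) auto
  then show ?case
    unfolding apply_adj_transps_Cons simple_reflection_def .
qed (simp add: id_in_parabolic)

text \<open>A transposition of \<open>x < y\<close> is a product of adjacent transpositions with
  indices in \<open>{x..<y}\<close>. The index range is half-open because
  \<open>simple_reflection k\<close> also moves \<open>k + 1\<close>.\<close>

lemma transpose_in_parabolic:
  assumes "{a..<b} \<subseteq> S" "x \<in> {a..b}" "y \<in> {a..b}" "x \<noteq> y"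
  shows "Transposition.transpose x y \<in> parabolic n S"
  using assms
proof (induction x y rule: linorder_wlog)
  case (le x y)
  then have "x < y" "{x..<y} \<subseteq> {a..<b}"
    by auto
  then have "set (adj_transp_seq x y) \<subseteq> S"
    using le.prems(1) by (simp only: set_adj_transp_seq order_trans)
  then show ?case
    using apply_adj_transps_in_parabolic adj_transp_seq_correct[OF \<open>x < y\<close>] by metis
qed (simp add: transpose_commute)

text \<open>Every permutation of a finite set is a product of transpositions of its points, so the
  case of one transposition suffices.\<close>

lemma permutes_interval_in_parabolic:
  assumes "p permutes {a..b}" "{a..<b} \<subseteq> S"
  shows "p \<in> parabolic n S"
  using assms(1) finite_atLeastAtMost
proof (induction rule: permutes_induct)
  case (swap x y q)
  then show ?case
    using assms(2) by (blast intro: comp_in_parabolic transpose_in_parabolic)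
qed (rule id_in_parabolic)

text \<open>For \<open>j \<noteq> i\<close>, the points \<open>j\<close> and \<open>j + 1\<close>
  lie both inside or both outside \<open>{1..i}\<close>; only \<open>simple_reflection i\<close>
  crosses the boundary.\<close>

lemma simple_reflection_stabilizes:
  assumes "j \<in> {1..n} - {i}"
  shows "simple_reflection j permutes {1..n + 1} \<and> simple_reflection j ` {1..i} = {1..i}"
  using assms unfolding simple_reflection_def
  by (auto intro!: permutes_swap_id transpose_image_eq)

lemma max_parabolic_imp_stabilizes:
  assumes "p \<in> max_parabolic n i"
  shows "p permutes {1..n + 1} \<and> p ` {1..i} = {1..i}"
  using assms unfolding max_parabolic_def parabolic_def
proof (induction rule: generate.induct)
  case one
  show ?case
    unfolding weyl_group_def sym_group_one by (intro conjI permutes_id) simp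
next
  case (incl h)
  then show ?case
    using simple_reflection_stabilizes by blast
next
  case (inv h)
  then obtain j where j: "j \<in> {1..n} - {i}" "h = simple_reflection j"
    by blast
  \<comment> \<open>A simple reflection is an involution, so inverses of generators add nothing
    new.\<close>
  then have "inv\<^bsub>weyl_group n\<^esub> h = h"
    using simple_reflection_stabilizes[OF j(1)]
    by (simp add: weyl_group_def sym_group_carrier simple_reflection_def)
  then show ?case
    using simple_reflection_stabilizes j by metis
next
  case (eng p q)
  then show ?case
    unfolding mult_weyl_group image_comp [symmetric] by (metis permutes_compose)
qed

lemma stabilizes_imp_max_parabolic:
  assumes "i \<le> n" "p permutes {1..n + 1}" "p ` {1..i} = {1..i}"
  shows "p \<in> max_parabolic n i"
proof -
  \<comment> \<open>Being injective, \<open>p\<close> also preserves the complementary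
    block.\<close>
  have "{1..n + 1} - {1..i} = {i + 1..n + 1}"
    using assms(1) by auto
  then have "p ` {i + 1..n + 1} = {i + 1..n + 1}"
    using assms permutes_image permutes_inj image_set_diff by metis
  then have bij: "bij_betw p {1..i} {1..i}" "bij_betw p {i + 1..n + 1} {i + 1..n + 1}"
    using assms by (auto simp: bij_betw_def intro: permutes_inj_on)
  \<comment> \<open>The generators acting inside the two blocks have exactly the indices in
    \<open>{1..n}\<close> other than \<open>i\<close>.\<close>
  have "{1..<i} \<subseteq> {1..n} - {i}" "{i + 1..<n + 1} \<subseteq> {1..n} - {i}"
    using assms(1) by auto
  then have "restrict_id p {1..i} \<in> max_parabolic n i"
    "restrict_id p {i + 1..n + 1} \<in> max_parabolic n i"
    unfolding max_parabolic_def
    using permutes_interval_in_parabolic permutes_restrict_id bij by blast+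
  moreover have "p = restrict_id p {1..i} \<circ> restrict_id p {i + 1..n + 1}"
  proof
    fix x
    \<comment> \<open>The right factor acts first. Its value on the upper block stays there, so the
      left factor, the identity off \<open>{1..i}\<close>, does not move it.\<close>
    have "x \<in> {i + 1..n + 1} \<Longrightarrow> p x \<in> {i + 1..n + 1}"
      using bij(2) by (rule bij_betwE[rule_format])
    then show "p x = (restrict_id p {1..i} \<circ> restrict_id p {i + 1..n + 1}) x"
      using permutes_not_in[OF assms(2), of x] assms(1) by (auto simp: restrict_id_def)
  qed
  ultimately show ?thesis
    unfolding max_parabolic_def by (metis comp_in_parabolic)
qed

text \<open>A left coset of a stabilizer consists of all group elements with the same effect on the
  stabilized set. This turns intersecting cosets into imposing conditions on images.\<close>

lemma l_coset_max_parabolic: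
  assumes "i \<le> n" "w permutes {1..n + 1}"
  shows "w <#\<^bsub>weyl_group n\<^esub> max_parabolic n i =
    {u. u permutes {1..n + 1} \<and> u ` {1..i} = multi_index w i}"
proof (intro equalityI subsetI)
  fix u assume "u \<in> w <#\<^bsub>weyl_group n\<^esub> max_parabolic n i"
  then obtain p where "u = w \<circ> p" "p permutes {1..n + 1}" "p ` {1..i} = {1..i}"
    using max_parabolic_imp_stabilizes by (auto simp: l_coset_weyl_group)
  then show "u \<in> {u. u permutes {1..n + 1} \<and> u ` {1..i} = multi_index w i}"
    using permutes_compose[OF _ assms(2)]
    unfolding multi_index_def mem_Collect_eq by (metis image_comp)
next
  fix u assume "u \<in> {u. u permutes {1..n + 1} \<and> u ` {1..i} = multi_index w i}"
  then have u: "u permutes {1..n + 1}" "u ` {1..i} = w ` {1..i}"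
    by (auto simp: multi_index_def)
  have "(inv' w \<circ> u) ` {1..i} = (inv' w \<circ> w) ` {1..i}"
    using u(2) by (metis image_comp)
  also have "\<dots> = {1..i}"
    using permutes_inv_o(2)[OF assms(2)] by simp
  finally have "inv' w \<circ> u \<in> max_parabolic n i"
    using assms u(1) by (intro stabilizes_imp_max_parabolic permutes_compose permutes_inv)
  moreover have "u = w \<circ> (inv' w \<circ> u)"
    by (simp add: o_assoc permutes_inv_o(1)[OF assms(2)])
  ultimately show "u \<in> w <#\<^bsub>weyl_group n\<^esub> max_parabolic n i"
    unfolding l_coset_weyl_group by blast
qed

lemma ex_permutes_multi_index:
  assumes "i \<le> n" "w permutes {1..n + 1}" "w' permutes {1..n + 1}"
    and sub: "multi_index w i \<subseteq> multi_index w' (i + 1)"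
  obtains u where "u permutes {1..n + 1}" "u ` {1..i} = multi_index w i"
    "u ` {1..i + 1} = multi_index w' (i + 1)"
proof -
  have "card (multi_index w i) = i" "card (multi_index w' (i + 1)) = i + 1"
    using assms(2,3) by (simp_all add: multi_index_def card_image permutes_inj_on)
  then have "card (multi_index w' (i + 1) - multi_index w i) = 1"
    using sub by (subst card_Diff_subset) (auto simp: multi_index_def)
  then obtain x where x: "multi_index w' (i + 1) - multi_index w i = {x}"
    by (auto simp: card_1_singleton_iff)
  then obtain y where y: "y \<in> {1..i + 1}" "x = w' y"
    unfolding multi_index_def by blast
  \<comment> \<open>Swapping before \<open>w'\<close> acts gives \<open>u (i + 1) = x\<close> and
    keeps the image of \<open>{1..i + 1}\<close>. For \<open>y = i + 1\<close> the swap is the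
    identity.\<close>
  define u where "u = w' \<circ> Transposition.transpose y (i + 1)"
  have u: "u permutes {1..n + 1}"
    unfolding u_def using y(1) assms(1,3) by (intro permutes_compose permutes_swap_id) auto
  have u': "u ` {1..i + 1} = multi_index w' (i + 1)"
    using y(1) transpose_image_eq[of y "{1..i + 1}" "i + 1"]
    unfolding u_def multi_index_def image_comp [symmetric] by simp
  have "{1..i} = {1..i + 1} - {i + 1}"
    by auto
  then have "u ` {1..i} = u ` {1..i + 1} - u ` {i + 1}"
    by (metis image_set_diff permutes_inj[OF u])
  also have "\<dots> = multi_index w' (i + 1) - {x}"
    using u' y(2) by (simp add: u_def)
  also have "\<dots> = multi_index w i"
    using x sub by blast
  finally show thesis
    using that u u' by blast
qed

theorem proposition4p1:
  fixes n i :: nat and w w' :: "nat \<Rightarrow> nat"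
  assumes "1 \<le> i" and "i \<le> n - 1"
    and "w \<in> carrier (weyl_group n)" and "w' \<in> carrier (weyl_group n)"
  shows "adjacent n (w <#\<^bsub>weyl_group n\<^esub> max_parabolic n i)
                    (w' <#\<^bsub>weyl_group n\<^esub> max_parabolic n (i + 1))
         \<longleftrightarrow> multi_index w i \<subseteq> multi_index w' (i + 1)"
proof -
  have i: "i \<in> {1..n}" "i + 1 \<in> {1..n}" "i \<le> n" "i + 1 \<le> n"
    using assms(1,2) by auto
  have w: "w permutes {1..n + 1}" "w' permutes {1..n + 1}"
    using assms(3,4) by (simp_all add: carrier_weyl_group)
  let ?F = "w <#\<^bsub>weyl_group n\<^esub> max_parabolic n i"
  let ?F' = "w' <#\<^bsub>weyl_group n\<^esub> max_parabolic n (i + 1)"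
  have "?F \<in> facets n" "?F' \<in> facets n"
    unfolding facets_def using assms(3,4) i(1,2) by blast+
  \<comment> \<open>Both cosets are facets, so only the intersection matters; \<open>u\<close> is a
    common element.\<close>
  then have "adjacent n ?F ?F' \<longleftrightarrow> (\<exists>u. u permutes {1..n + 1} \<and>
      u ` {1..i} = multi_index w i \<and> u ` {1..i + 1} = multi_index w' (i + 1))"
    unfolding adjacent_def l_coset_max_parabolic[OF i(3) w(1)] l_coset_max_parabolic[OF i(4) w(2)]
    by blast
  also have "\<dots> \<longleftrightarrow> multi_index w i \<subseteq> multi_index w' (i + 1)"
  proof
    assume "multi_index w i \<subseteq> multi_index w' (i + 1)"
    then show "\<exists>u. u permutes {1..n + 1} \<and>
        u ` {1..i} = multi_index w i \<and> u ` {1..i + 1} = multi_index w' (i + 1)"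
      using ex_permutes_multi_index[OF i(3) w] by metis
  next
    assume "\<exists>u. u permutes {1..n + 1} \<and>
        u ` {1..i} = multi_index w i \<and> u ` {1..i + 1} = multi_index w' (i + 1)"
    then show "multi_index w i \<subseteq> multi_index w' (i + 1)"
      using image_mono[of "{1..i}" "{1..i + 1}"] by fastforce
  qed
  finally show ?thesis .
qed

end
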